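(* Let $X\neq\emptyset$ be a set and let $\mathcal E\colon\mathcal F(X)\to[0,\infty]$ be a nonlinear resistance form. (a) The triangle inequality $\mathcal R_t(x,z)\le\mathcal R_t(x,y)+\mathcal R_t(y,z)$ holds for all $x,y,z\in X$ and $t>0$. (b) If $\mathcal E$ is symmetric, then $\mathcal R_t(x,y)=\mathcal R_t(y,x)$ for all $x,y\in X$ and $t>0$. (c) If $\mathcal E$ satisfies the $\nabla_2$-condition, then $\mathcal R_t(x,y)<\infty$ for all $x,y\in X$ and $t>0$. In particular, if $\mathcal E$ is symmetric and satisfies the $\nabla_2$-condition, then for each $t>0$ the function $\mathcal R_t$ is a pseudometric.
   Context: $\mathcal F(X)$ is the real vector space of all functions $f\colon X\to\mathbb R$, equipped with the topology of pointwise convergence. A functional $\mathcal E\colon\mathcal F(X)\to[0,\infty]$ is called a nonlinear resistance form if: (1) $\mathcal E$ is convex with $\mathcal E(0)=0$; (2) $\mathcal E$ is lower semicontinuous with respect to pointwise convergence, i.e. $\mathcal E(f)\le\liminf_i\mathcal E(f_i)$ for every net $f_i\to f$ pointwise; (3) $R(x,y)<\infty$ for all $x,y\in X$, where $R(x,y)=\sup\{f(x)-f(y)\mid\mathcal E(f)\le1\}$; (4) all normal contractions operate on $\mathcal E$, i.e. for every $1$-Lipschitz $C\colon\mathbb R\to\mathbb R$ with $C(0)=0$ and all $f,g\in\mathcal F(X)$, $\mathcal E(f+C\circ g)+\mathcal E(f-C\circ g)\le\mathcal E(f+g)+\mathcal E(f-g)$. For $t>0$ and $x,y\in X$ the $t$-resistance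 is $\mathcal R_t(x,y)=\sup\{t(f(x)-f(y))-\mathcal E(f)\mid f\in\mathcal F(X)\}\in[0,\infty]$. $\mathcal E$ is symmetric if $\mathcal E(f)=\mathcal E(-f)$ for all $f$. With $D(\mathcal E)=\{f\mid\mathcal E(f)<\infty\}$, $\mathcal E$ satisfies the $\nabla_2$-condition if there exists $K>2$ such that $K\mathcal E(f)\le\mathcal E(2f)$ for all $f\in D(\mathcal E)$. *)

theory Defs
  imports "HOL-Analysis.Analysis"
begin

text \<open>
  The set \<open>X\<close> is the (automatically nonempty) type \<open>'a\<close>, so that \<open>\<F>(X)\<close> is the type
  \<open>'a \<Rightarrow> real\<close>. Functionals with values in \<open>[0,\<infinity>]\<close> have codomain \<^typ>\<open>ennreal\<close>,
  where \<open>0 * \<infinity> = 0\<close>.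
\<close>

definition convex_functional :: "(('a \<Rightarrow> real) \<Rightarrow> ennreal) \<Rightarrow> bool" where
  "convex_functional E \<longleftrightarrow>
     (\<forall>f g. \<forall>s\<in>{0..1::real}.
        E (\<lambda>x. (1 - s) * f x + s * g x) \<le> ennreal (1 - s) * E f + ennreal s * E g)"

text \<open>
  Nets in \<open>\<F>(X)\<close> are represented by filters on \<open>\<F>(X)\<close>: a net \<open>(f\<^sub>i)\<close> induces the filter
  generated by its tails. Every index filter is covered, see \<open>lsc_functional_netD\<close> below.
\<close>

definition lsc_functional :: "(('a \<Rightarrow> real) \<Rightarrow> ennreal) \<Rightarrow> bool" where
  "lsc_functional E \<longleftrightarrow>
     (\<forall>f. \<forall>F :: ('a \<Rightarrow> real) filter.
        (\<forall>x. ((\<lambda>g. g x) \<longlongrightarrow> f x) F) \<longrightarrow> E f \<le> Liminf F E)"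

lemma lsc_functional_netD:
  fixes E :: "('a \<Rightarrow> real) \<Rightarrow> ennreal" and G :: "'i filter"
  assumes "lsc_functional E" and "\<And>x. ((\<lambda>i. fs i x) \<longlongrightarrow> f x) G"
  shows "E f \<le> Liminf G (\<lambda>i. E (fs i))"
proof -
  have "\<forall>x. ((\<lambda>g. g x) \<longlongrightarrow> f x) (filtermap fs G)"
    using assms(2) by (simp add: filterlim_filtermap)
  then have "E f \<le> Liminf (filtermap fs G) E"
    using assms(1) unfolding lsc_functional_def by blast
  then show ?thesis
    using Liminf_filtermap_le[of fs G E] by (rule order_trans)
qed

definition resistance :: "(('a \<Rightarrow> real) \<Rightarrow> ennreal) \<Rightarrow> 'a \<Rightarrow> 'a \<Rightarrow> ereal" where
  "resistance E x y = (SUP f\<in>{f. E f \<le> 1}. ereal (f x - f y))"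

definition normal_contractions_operate :: "(('a \<Rightarrow> real) \<Rightarrow> ennreal) \<Rightarrow> bool" where
  "normal_contractions_operate E \<longleftrightarrow>
     (\<forall>C :: real \<Rightarrow> real. 1-lipschitz_on UNIV C \<and> C 0 = 0 \<longrightarrow>
        (\<forall>f g. E (\<lambda>x. f x + C (g x)) + E (\<lambda>x. f x - C (g x))
                \<le> E (\<lambda>x. f x + g x) + E (\<lambda>x. f x - g x)))"

definition nonlinear_resistance_form :: "(('a \<Rightarrow> real) \<Rightarrow> ennreal) \<Rightarrow> bool" where
  "nonlinear_resistance_form E \<longleftrightarrow>
     convex_functional E \<and> E (\<lambda>x. 0) = 0 \<and>
     lsc_functional E \<and>
     (\<forall>x y. resistance E x y < \<infinity>) \<and>
     normal_contractions_operate E"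

text \<open>The supremum is taken in \<^typ>\<open>ereal\<close>; functions of infinite energy contribute \<open>-\<infinity>\<close>.\<close>

definition t_resistance :: "(('a \<Rightarrow> real) \<Rightarrow> ennreal) \<Rightarrow> real \<Rightarrow> 'a \<Rightarrow> 'a \<Rightarrow> ereal" where
  "t_resistance E t x y = (SUP f. ereal (t * (f x - f y)) - enn2ereal (E f))"

definition symmetric_functional :: "(('a \<Rightarrow> real) \<Rightarrow> ennreal) \<Rightarrow> bool" where
  "symmetric_functional E \<longleftrightarrow> (\<forall>f. E f = E (\<lambda>x. - f x))"

definition effective_domain :: "(('a \<Rightarrow> real) \<Rightarrow> ennreal) \<Rightarrow> ('a \<Rightarrow> real) set" where
  "effective_domain E = {f. E f < \<infinity>}"

definition nabla2 :: "(('a \<Rightarrow> real) \<Rightarrow> ennreal) \<Rightarrow> bool" where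
  "nabla2 E \<longleftrightarrow>
     (\<exists>K::real. K > 2 \<and> (\<forall>f\<in>effective_domain E. ennreal K * E f \<le> E (\<lambda>x. 2 * f x)))"

text \<open>Pseudometrics are finite-valued, although the codomain used here is \<^typ>\<open>ereal\<close>.\<close>

definition pseudometric :: "('a \<Rightarrow> 'a \<Rightarrow> ereal) \<Rightarrow> bool" where
  "pseudometric d \<longleftrightarrow>
     (\<forall>x y. 0 \<le> d x y \<and> d x y < \<infinity>) \<and>
     (\<forall>x. d x x = 0) \<and>
     (\<forall>x y. d x y = d y x) \<and>
     (\<forall>x y z. d x z \<le> d x y + d y z)"

end

theory Submission
  imports Defs
begin

text \<open>
  For the triangle inequality, truncate a competitor \<open>f\<close> for the pair \<open>(x, z)\<close> at the level
  \<open>a = f y\<close>, splitting it as \<open>f = g + h\<close>. One summand carries at least the increment from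
  \<open>y\<close> to \<open>x\<close>, the other one at least that from \<open>z\<close> to \<open>y\<close>. Normal contractions, applied with
  both functions equal to \<open>f / 2\<close>, give \<open>E g + E h \<le> E f\<close>. As \<open>E\<close> need not be invariant under
  adding constants, both summands must vanish where \<open>f\<close> does, and the splitting depends on the
  sign of \<open>a\<close>. For finiteness, halve \<open>f\<close> until its energy is at most \<open>1\<close>, say \<open>n\<close> times: then
  \<open>f x - f y\<close> is at most \<open>2 ^ n\<close> times the resistance, whereas \<open>E f \<ge> K ^ (n - 1)\<close>
  with \<open>K > 2\<close>.
\<close>

text \<open>Monotonicity of \<open>\<phi>\<close> and of \<open>s - \<phi> s\<close> says that
  \<open>\<phi>\<close> has difference quotients in [0, 1], which is what makes the rescaled and
  recentred function \<open>C\<close> below a normal contraction.\<close>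

lemma energy_split:
  fixes E :: "('a \<Rightarrow> real) \<Rightarrow> ennreal" and \<phi> :: "real \<Rightarrow> real"
  assumes "normal_contractions_operate E" and "E (\<lambda>x. 0) = 0"
    and "\<phi> 0 = 0" and "mono \<phi>" and "mono (\<lambda>s. s - \<phi> s)"
  shows "E (\<lambda>x. \<phi> (f x)) + E (\<lambda>x. f x - \<phi> (f x)) \<le> E f"
proof -
  \<comment> \<open>\<open>C\<close> solves \<open>f / 2 + C (f / 2) = \<phi> f\<close>; then
    \<open>f / 2 - C (f / 2)\<close> is the remainder \<open>f - \<phi> f\<close>.\<close>
  define C where "C = (\<lambda>s. \<phi> (2 * s) - s)"
  have C_le: "\<bar>C r - C s\<bar> \<le> \<bar>r - s\<bar>" if "r \<le> s" for r s
    using monoD[OF assms(4), of "2 * r" "2 * s"] monoD[OF assms(5), of "2 * r" "2 * s"] that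
    by (auto simp: C_def)
  have "1-lipschitz_on UNIV C"
  proof (rule lipschitz_onI)
    fix r s :: real
    show "dist (C r) (C s) \<le> 1 * dist r s"
      using C_le[of r s] C_le[of s r] by (cases "r \<le> s") (auto simp: dist_real_def)
  qed simp
  moreover have "C 0 = 0"
    by (simp add: C_def assms(3))
  ultimately have "E (\<lambda>x. f x / 2 + C (f x / 2)) + E (\<lambda>x. f x / 2 - C (f x / 2))
      \<le> E (\<lambda>x. f x / 2 + f x / 2) + E (\<lambda>x. f x / 2 - f x / 2)"
    using assms(1)[unfolded normal_contractions_operate_def, rule_format, of C "\<lambda>x. f x / 2" "\<lambda>x. f x / 2"]
    by blast
  then show ?thesis
    by (simp add: C_def assms(2))
qed

lemma energy_split_at_level:
  fixes E :: "('a \<Rightarrow> real) \<Rightarrow> ennreal"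
  assumes "normal_contractions_operate E" and "E (\<lambda>x. 0) = 0"
  obtains g h where "E g + E h \<le> E f"
    and "\<And>x. f x - f y \<le> g x - g y" and "\<And>z. f y - f z \<le> h y - h z"
proof (cases "0 \<le> f y")
  case True
  show ?thesis
  proof
    \<comment> \<open>With \<open>a = f y\<close>, the summands are \<open>g = max (f - a) 0\<close>
      and \<open>h = min f a\<close>. The cut-off \<open>min s a\<close> fixes 0 because
      \<open>a \<ge> 0\<close>.\<close>
    show "E (\<lambda>x. f x - min (f x) (f y)) + E (\<lambda>x. min (f x) (f y)) \<le> E f"
      using energy_split[OF assms, of "\<lambda>s. min s (f y)" f] True
      by (auto simp: mono_def min_def add.commute)
  qed auto
next
  case False
  show ?thesis
  proof
    \<comment> \<open>Now \<open>g = max f a\<close> and \<open>h = min (f - a) 0\<close>: the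
      constant \<open>a\<close> has moved from \<open>h\<close> to \<open>g\<close>, so that both
      vanish where \<open>f\<close> does although \<open>a < 0\<close>.\<close>
    show "E (\<lambda>x. f x - min (f x - f y) 0) + E (\<lambda>x. min (f x - f y) 0) \<le> E f"
      using energy_split[OF assms, of "\<lambda>s. min (s - f y) 0" f] False
      by (auto simp: mono_def min_def add.commute)
  qed auto
qed

text \<open>With its converse \<open>t_resistance_least\<close>, this reduces the supremum to real
  arithmetic. Finiteness matters: \<open>enn2real\<close> sends infinite energy to 0, whereas such
  functions contribute -\<infinity>.\<close>

lemma t_resistance_upper:
  assumes "E f < \<infinity>"
  shows "ereal (t * (f x - f y) - enn2real (E f)) \<le> t_resistance E t x y"
proof -
  have "ereal (t * (f x - f y) - enn2real (E f)) = ereal (t * (f x - f y)) - enn2ereal (E f)"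
    using assms by (cases "E f") auto
  also have "\<dots> \<le> t_resistance E t x y"
    unfolding t_resistance_def by (rule SUP_upper) simp
  finally show ?thesis .
qed

lemma t_resistance_least:
  assumes "\<And>f. E f < \<infinity> \<Longrightarrow> ereal (t * (f x - f y) - enn2real (E f)) \<le> b"
  shows "t_resistance E t x y \<le> b"
  unfolding t_resistance_def
proof (rule SUP_least)
  fix f
  show "ereal (t * (f x - f y)) - enn2ereal (E f) \<le> b"
    using assms[of f] by (cases "E f") auto
qed

lemma t_resistance_nonneg:
  assumes "E (\<lambda>x. 0) = 0"
  shows "0 \<le> t_resistance E t x y"
  using t_resistance_upper[of E "\<lambda>x. 0" t x y] assms by (simp add: zero_ereal_def)

lemma t_resistance_self:
  assumes "E (\<lambda>x. 0) = 0"
  shows "t_resistance E t x x = 0"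
proof (rule antisym)
  show "t_resistance E t x x \<le> 0"
    by (rule t_resistance_least) simp
qed (rule t_resistance_nonneg[where E = E, OF assms])

lemma t_resistance_triangle:
  fixes E :: "('a \<Rightarrow> real) \<Rightarrow> ennreal"
  assumes "normal_contractions_operate E" and "E (\<lambda>x. 0) = 0" and "0 \<le> t"
  shows "t_resistance E t x z \<le> t_resistance E t x y + t_resistance E t y z"
proof (rule t_resistance_least)
  fix f assume fin: "E f < \<infinity>"
  obtain g h where split: "E g + E h \<le> E f"
    and g: "f x - f y \<le> g x - g y" and h: "f y - f z \<le> h y - h z"
    using energy_split_at_level[OF assms(1,2), of f y] by metis
  have "E g + E h < top"
    using split fin unfolding infinity_ennreal_def by (rule le_less_trans)
  then have fin_g: "E g < top" and fin_h: "E h < top"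
    by simp_all
  have "enn2real (E g) + enn2real (E h) \<le> enn2real (E f)"
    using enn2real_mono[OF split] fin fin_g fin_h by (simp add: enn2real_plus)
  moreover have "t * (f x - f z) \<le> t * (g x - g y) + t * (h y - h z)"
    using mult_left_mono[OF add_mono[OF g h] assms(3)] by (simp add: algebra_simps)
  ultimately have "ereal (t * (f x - f z) - enn2real (E f))
      \<le> ereal (t * (g x - g y) - enn2real (E g)) + ereal (t * (h y - h z) - enn2real (E h))"
    by simp
  also have "\<dots> \<le> t_resistance E t x y + t_resistance E t y z"
    using fin_g fin_h by (intro add_mono t_resistance_upper) simp_all
  finally show "ereal (t * (f x - f z) - enn2real (E f))
      \<le> t_resistance E t x y + t_resistance E t y z" .
qed

text \<open>A competitor \<open>f\<close> for one order of the points corresponds to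
  \<open>- f\<close> for the other.\<close>

lemma t_resistance_symmetric:
  assumes "symmetric_functional E"
  shows "t_resistance E t x y = t_resistance E t y x"
proof -
  have le: "t_resistance E t x y \<le> t_resistance E t y x" for x y
  proof (rule t_resistance_least)
    fix f assume "E f < \<infinity>"
    moreover have "E (\<lambda>x. - f x) = E f"
      using assms by (simp add: symmetric_functional_def)
    ultimately show "ereal (t * (f x - f y) - enn2real (E f)) \<le> t_resistance E t y x"
      using t_resistance_upper[of E "\<lambda>x. - f x" t y x] by (simp add: algebra_simps)
  qed
  show ?thesis
    by (rule antisym) (rule le)+
qed

lemma convex_functional_scale_le:
  fixes E :: "('a \<Rightarrow> real) \<Rightarrow> ennreal"
  assumes "convex_functional E" and "E (\<lambda>x. 0) = 0" and "0 \<le> s" and "s \<le> 1"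
  shows "E (\<lambda>x. s * f x) \<le> ennreal s * E f"
  using assms(1)[unfolded convex_functional_def, rule_format, of s "\<lambda>x. 0" f] assms(2-4)
  by simp

lemma nabla2_power_growth:
  fixes E :: "('a \<Rightarrow> real) \<Rightarrow> ennreal"
  assumes "convex_functional E" and "E (\<lambda>x. 0) = 0" and "0 \<le> K"
    and "\<And>f. E f < \<infinity> \<Longrightarrow> ennreal K * E f \<le> E (\<lambda>x. 2 * f x)" and "E f < \<infinity>"
  shows "ennreal (K ^ n) * E (\<lambda>x. (1/2) ^ n * f x) \<le> E f"
proof (induction n)
  case (Suc n)
  \<comment> \<open>The growth condition is available only at finite energy; convexity passes
    finiteness from \<open>f\<close> to its halvings.\<close>
  have "E (\<lambda>x. (1/2) ^ Suc n * f x) \<le> ennreal ((1/2) ^ Suc n) * E f"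
    by (rule convex_functional_scale_le[OF assms(1,2)]) (auto intro: power_le_one simp del: power_Suc)
  also have "\<dots> < \<infinity>"
    using assms(5) by (simp add: ennreal_mult_less_top del: power_Suc)
  finally have "ennreal K * E (\<lambda>x. (1/2) ^ Suc n * f x) \<le> E (\<lambda>x. 2 * ((1/2) ^ Suc n * f x))"
    by (rule assms(4))
  also have "(\<lambda>x. 2 * ((1/2) ^ Suc n * f x)) = (\<lambda>x. (1/2) ^ n * f x)"
    by simp
  finally have "ennreal (K ^ n) * (ennreal K * E (\<lambda>x. (1/2) ^ Suc n * f x))
      \<le> ennreal (K ^ n) * E (\<lambda>x. (1/2) ^ n * f x)"
    by (rule mult_left_mono) simp
  also have "\<dots> \<le> E f"
    by (rule Suc.IH)
  finally show ?case
    using assms(3) by (simp add: ennreal_mult mult.assoc mult.left_commute)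
qed simp

lemma exists_halving:
  fixes E :: "('a \<Rightarrow> real) \<Rightarrow> ennreal"
  assumes "convex_functional E" and "E (\<lambda>x. 0) = 0" and "E f < \<infinity>"
  shows "\<exists>n. E (\<lambda>x. (1/2) ^ n * f x) \<le> 1"
proof -
  obtain n where n: "enn2real (E f) < 2 ^ n"
    using real_arch_pow[of 2 "enn2real (E f)"] by auto
  have "E (\<lambda>x. (1/2) ^ n * f x) \<le> ennreal ((1/2) ^ n) * E f"
    by (rule convex_functional_scale_le[OF assms(1,2)]) (auto intro: power_le_one)
  also have "\<dots> = ennreal ((1/2) ^ n) * ennreal (enn2real (E f))"
    using assms(3) by simp
  also have "\<dots> = ennreal ((1/2) ^ n * enn2real (E f))"
    by (simp add: ennreal_mult)
  also have "\<dots> \<le> 1"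
    using n by (simp add: field_simps power_divide)
  finally show ?thesis by blast
qed

lemma t_resistance_finite:
  fixes E :: "('a \<Rightarrow> real) \<Rightarrow> ennreal"
  assumes "convex_functional E" and zero: "E (\<lambda>x. 0) = 0"
    and "resistance E x y < \<infinity>" and "nabla2 E" and "0 \<le> t"
  shows "t_resistance E t x y < \<infinity>"
proof -
  have upper: "ereal (f x - f y) \<le> resistance E x y" if "E f \<le> 1" for f
    unfolding resistance_def by (rule SUP_upper) (use that in simp)
  obtain R where R: "resistance E x y = ereal R" and "0 \<le> R"
    using upper[of "\<lambda>x. 0"] zero assms(3) by (cases "resistance E x y") auto
  obtain K where "K > 2" and K: "\<And>f. E f < \<infinity> \<Longrightarrow> ennreal K * E f \<le> E (\<lambda>x. 2 * f x)"
    using assms(4) by (auto simp: nabla2_def effective_domain_def)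
  have "(\<lambda>n. t * R * (2 / K) ^ n) \<longlonglongrightarrow> t * R * 0"
    using \<open>K > 2\<close> by (intro tendsto_intros LIMSEQ_power_zero) simp
  \<comment> \<open>The threshold \<open>1 / K\<close> pays for the lost factor in
    \<open>K ^ (n - 1)\<close>: the inequality rearranges to
    \<open>t * R * 2 ^ n < K ^ (n - 1)\<close>. The resulting \<open>N\<close> does not depend on
    the competitor.\<close>
  then have "\<forall>\<^sub>F n in sequentially. t * R * (2 / K) ^ n < 1 / K"
    by (rule order_tendstoD(2)) (use \<open>K > 2\<close> in \<open>simp add: divide_pos_pos\<close>)
  then obtain N where N: "t * R * (2 / K) ^ n < 1 / K" if "n \<ge> N" for n
    by (auto simp: eventually_sequentially)
  have "t_resistance E t x y \<le> ereal (t * R * 2 ^ N)"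
  proof (rule t_resistance_least)
    fix f assume fin: "E f < \<infinity>"
    define n where "n = (LEAST n. E (\<lambda>x. (1/2) ^ n * f x) \<le> 1)"
    have "E (\<lambda>x. (1/2) ^ n * f x) \<le> 1"
      unfolding n_def by (rule LeastI_ex) (rule exists_halving[OF assms(1) zero fin])
    from upper[OF this] have "f x - f y \<le> 2 ^ n * R"
      by (simp add: R field_simps power_divide)
    then have bound: "t * (f x - f y) \<le> t * R * 2 ^ n"
      using mult_left_mono[OF _ assms(5)] by (fastforce simp: mult_ac)
    have "t * (f x - f y) - enn2real (E f) \<le> t * R * 2 ^ N"
    proof (cases "n \<le> N")
      case True
      then have "t * R * 2 ^ n \<le> t * R * 2 ^ N"
        using assms(5) \<open>0 \<le> R\<close> by (intro mult_left_mono power_increasing) auto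
      then show ?thesis
        using bound enn2real_nonneg[of "E f"] by linarith
    next
      case False
      \<comment> \<open>By minimality of \<open>n\<close>, halving \<open>m\<close> times leaves
        energy above 1, hence \<open>K ^ m \<le> E f\<close>. Beyond \<open>N\<close> this outweighs
        the linear term, and the difference is at most 0.\<close>
      then obtain m where m: "n = Suc m"
        by (cases n) auto
      then have "1 \<le> E (\<lambda>x. (1/2) ^ m * f x)"
        using not_less_Least[of m "\<lambda>n. E (\<lambda>x. (1/2) ^ n * f x) \<le> 1"] by (simp add: n_def)
      from mult_left_mono[OF this, of "ennreal (K ^ m)"] have "ennreal (K ^ m) \<le> E f"
        using nabla2_power_growth[OF assms(1) zero _ K fin, of m] \<open>K > 2\<close> by simp
      then have "K ^ m \<le> enn2real (E f)"
        using enn2real_mono[of "ennreal (K ^ m)" "E f"] fin \<open>K > 2\<close> by simp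
      moreover have "t * R * 2 ^ n \<le> K ^ m"
        using N[of n] False \<open>K > 2\<close> by (simp add: m field_simps power_divide)
      moreover have "0 \<le> t * R * 2 ^ N"
        using assms(5) \<open>0 \<le> R\<close> by simp
      ultimately show ?thesis
        using bound by linarith
    qed
    then show "ereal (t * (f x - f y) - enn2real (E f)) \<le> ereal (t * R * 2 ^ N)"
      by simp
  qed
  then show ?thesis
    using le_less_trans by fastforce
qed

theorem theorem4p13:
  fixes E :: "('a \<Rightarrow> real) \<Rightarrow> ennreal"
  assumes "nonlinear_resistance_form E"
  shows
    "(\<forall>t>0. \<forall>x y z. t_resistance E t x z \<le> t_resistance E t x y + t_resistance E t y z) \<and>
     (symmetric_functional E \<longrightarrow>
        (\<forall>t>0. \<forall>x y. t_resistance E t x y = t_resistance E t y x)) \<and>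
     (nabla2 E \<longrightarrow> (\<forall>t>0. \<forall>x y. t_resistance E t x y < \<infinity>)) \<and>
     (symmetric_functional E \<and> nabla2 E \<longrightarrow> (\<forall>t>0. pseudometric (t_resistance E t)))"
proof -
  have E: "convex_functional E" "E (\<lambda>x. 0) = 0" "\<And>x y. resistance E x y < \<infinity>"
    "normal_contractions_operate E"
    using assms by (simp_all add: nonlinear_resistance_form_def)
  have triangle: "t_resistance E t x z \<le> t_resistance E t x y + t_resistance E t y z"
    if "t > 0" for t x y z
    using t_resistance_triangle[OF E(4,2)] that by simp
  have finite: "t_resistance E t x y < \<infinity>" if "nabla2 E" "t > 0" for t x y
    using t_resistance_finite[OF E(1-3)] that by simp
  have pseudometric: "pseudometric (t_resistance E t)" if "symmetric_functional E" "nabla2 E" "t > 0" for t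
    unfolding pseudometric_def
    by (intro conjI allI)
      (rule t_resistance_nonneg[of E, OF E(2)] t_resistance_self[of E, OF E(2)]
        t_resistance_symmetric[OF that(1)] triangle[OF that(3)] finite[OF that(2,3)])+
  show ?thesis
    by (intro conjI allI impI; (elim conjE)?;
      rule triangle finite t_resistance_symmetric pseudometric; assumption)
qed

end
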